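(* Let $\alpha\in(0,1)$, $U=\prod_{i=1}^d[0,b_i]\subset\mathbb{R}^d$ with all $b_i>0$, and $p\in U$. For each $i\in\{1,\dots,d\}$, the set $\mathfrak{D}_i^\alpha(p)$ of $i$-th fractional derivations of order $\alpha$ at $p$ is a one-dimensional real vector space (a linear subspace of the space of linear functionals on $\mathcal{A}_i^\alpha(U)$), and $$\mathfrak{D}_i^\alpha(p)=\mathbb{R}\cdot\bigl((\partial_{C,i}^\alpha)|_p\bigr),$$ where $(\partial_{C,i}^\alpha)|_p$ denotes the functional $f\mapsto(\partial_{C,i}^\alpha f)(p)$ on $\mathcal{A}_i^\alpha(U)$. More precisely, every $D_i\in\mathfrak{D}_i^\alpha(p)$ satisfies $$D_i(f)=\lambda_i(D_i)\,(\partial_{C,i}^\alpha f)(p)\qquad\text{for all } f\in\mathcal{A}_i^\alpha(U).$$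
   Context: Fix $\alpha\in(0,1)$, a rectangle $U=\prod_{i=1}^d[0,b_i]$, $b_i>0$, and a base point $p\in U$. For $f\in C(U)$ (real-valued continuous functions) the left Riemann--Liouville integral of order $\alpha$ in the $i$-th variable is $$(I_i^\alpha f)(x)=\frac{1}{\Gamma(\alpha)}\int_0^{x_i}(x_i-\xi)^{\alpha-1}f(x_1,\dots,x_{i-1},\xi,x_{i+1},\dots,x_d)\,d\xi.$$ Define $\mathcal{A}_i^\alpha(U)=\{f\in C(U):\exists h_i\in C(U),\ f=I_i^\alpha h_i\}$, a real vector space. For $f\in\mathcal{A}_i^\alpha(U)$ the function $h_i\in C(U)$ with $f=I_i^\alpha h_i$ is unique, and the coordinatewise anchored Caputo derivative is defined by $\partial_{C,i}^\alpha f:=h_i\in C(U)$. An $i$-th fractional derivation of order $\alpha$ at $p$ is a linear map $D_i:\mathcal{A}_i^\alpha(U)\to\mathbb{R}$ for which there exists a scalar $\lambda_i(D_i)\in\mathbb{R}$ with $D_i(I_i^\alpha h)=\lambda_i(D_i)\,h(p)$ for every $h\in C(U)$. This scalar is uniquely determined (it equals $D_i(I_i^\alpha 1)$). $\mathfrak{D}_i^\alpha(p)$ denotes the set of all such maps. *)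

theory Defs
  imports "HOL-Analysis.Analysis" "HOL-Library.Function_Algebras"
begin

text \<open>
  Real-valued functions on a set are represented by functions on the ambient type that vanish
  outside that set. Hence two functions on \<open>U\<close> (or two functionals on a space of functions) agree
  on their domain iff they are equal, and function spaces are subspaces of the vector space of
  all functions \<open>'a \<Rightarrow> real\<close> with pointwise operations.
\<close>

definition fscale :: "real \<Rightarrow> ('a \<Rightarrow> real) \<Rightarrow> 'a \<Rightarrow> real" where
  "fscale c f = (\<lambda>x. c * f x)"

global_interpretation fun_space: vector_space "fscale :: real \<Rightarrow> ('a \<Rightarrow> real) \<Rightarrow> 'a \<Rightarrow> real"
  by unfold_locales (auto simp: fscale_def fun_eq_iff algebra_simps)

definition linear_functionals :: "('a \<Rightarrow> real) set \<Rightarrow> (('a \<Rightarrow> real) \<Rightarrow> real) set" where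
  "linear_functionals A = {D.
     (\<forall>f\<in>A. \<forall>g\<in>A. D (f + g) = D f + D g) \<and>
     (\<forall>c. \<forall>f\<in>A. D (fscale c f) = c * D f) \<and>
     (\<forall>f. f \<notin> A \<longrightarrow> D f = 0)}"

lemma subspace_linear_functionals: "fun_space.subspace (linear_functionals A)"
  unfolding fun_space.subspace_def linear_functionals_def
  by (auto simp: fscale_def algebra_simps)

definition continuous_funs :: "'a::topological_space set \<Rightarrow> ('a \<Rightarrow> real) set" where
  "continuous_funs U = {f. continuous_on U f \<and> (\<forall>x. x \<notin> U \<longrightarrow> f x = 0)}"

lemma subspace_continuous_funs: "fun_space.subspace (continuous_funs U)"
proof (rule fun_space.subspaceI)
  show "0 \<in> continuous_funs U"
    by (auto simp: continuous_funs_def zero_fun_def)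
  show "f + g \<in> continuous_funs U" if "f \<in> continuous_funs U" "g \<in> continuous_funs U" for f g
    using that by (auto simp: continuous_funs_def plus_fun_def intro: continuous_on_add)
  show "fscale c f \<in> continuous_funs U" if "f \<in> continuous_funs U" for c f
    using that by (auto simp: continuous_funs_def fscale_def intro: continuous_on_mult_left)
qed

text \<open>
  The vector \<open>b\<close> is the upper corner of the rectangle \<open>U = cbox 0 b\<close>, i.e. the product of the
  intervals \<open>{0..b $ j}\<close>.
\<close>

definition RL_integral ::
  "real ^ 'n \<Rightarrow> real \<Rightarrow> 'n \<Rightarrow> (real ^ 'n \<Rightarrow> real) \<Rightarrow> real ^ 'n \<Rightarrow> real" where
  "RL_integral b \<alpha> i f = (\<lambda>x. if x \<in> cbox 0 b
     then 1 / Gamma \<alpha> *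
       integral {0..x $ i} (\<lambda>\<xi>. (x $ i - \<xi>) powr (\<alpha> - 1) * f (\<chi> j. if j = i then \<xi> else x $ j))
     else 0)"

definition RL_range :: "real ^ 'n \<Rightarrow> real \<Rightarrow> 'n \<Rightarrow> (real ^ 'n \<Rightarrow> real) set" where
  "RL_range b \<alpha> i = {f \<in> continuous_funs (cbox 0 b).
     \<exists>h \<in> continuous_funs (cbox 0 b). f = RL_integral b \<alpha> i h}"

definition caputo_deriv ::
  "real ^ 'n \<Rightarrow> real \<Rightarrow> 'n \<Rightarrow> (real ^ 'n \<Rightarrow> real) \<Rightarrow> real ^ 'n \<Rightarrow> real" where
  "caputo_deriv b \<alpha> i f =
     (THE h. h \<in> continuous_funs (cbox 0 b) \<and> f = RL_integral b \<alpha> i h)"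

definition caputo_deriv_at ::
  "real ^ 'n \<Rightarrow> real \<Rightarrow> 'n \<Rightarrow> real ^ 'n \<Rightarrow> (real ^ 'n \<Rightarrow> real) \<Rightarrow> real" where
  "caputo_deriv_at b \<alpha> i p = (\<lambda>f. if f \<in> RL_range b \<alpha> i then caputo_deriv b \<alpha> i f p else 0)"

definition fractional_derivations ::
  "real ^ 'n \<Rightarrow> real \<Rightarrow> 'n \<Rightarrow> real ^ 'n \<Rightarrow> ((real ^ 'n \<Rightarrow> real) \<Rightarrow> real) set" where
  "fractional_derivations b \<alpha> i p = {D \<in> linear_functionals (RL_range b \<alpha> i).
     \<exists>c. \<forall>h \<in> continuous_funs (cbox 0 b). D (RL_integral b \<alpha> i h) = c * h p}"

definition derivation_scalar ::
  "real ^ 'n \<Rightarrow> real \<Rightarrow> 'n \<Rightarrow> real ^ 'n \<Rightarrow> ((real ^ 'n \<Rightarrow> real) \<Rightarrow> real) \<Rightarrow> real" where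
  "derivation_scalar b \<alpha> i p D =
     (THE c. \<forall>h \<in> continuous_funs (cbox 0 b). D (RL_integral b \<alpha> i h) = c * h p)"

lemma derivation_scalar_unique:
  assumes "p \<in> cbox 0 b" "D \<in> fractional_derivations b \<alpha> i p"
  shows "\<exists>!c. \<forall>h \<in> continuous_funs (cbox 0 b). D (RL_integral b \<alpha> i h) = c * h p"
proof -
  have one: "indicator (cbox 0 b) \<in> continuous_funs (cbox 0 b)"
    by (auto simp: continuous_funs_def indicator_def cong: continuous_on_cong)
  obtain c where c: "\<forall>h \<in> continuous_funs (cbox 0 b). D (RL_integral b \<alpha> i h) = c * h p"
    using assms(2) by (auto simp: fractional_derivations_def)
  show ?thesis
  proof (rule ex1I[of _ c])
    fix c' assume "\<forall>h \<in> continuous_funs (cbox 0 b). D (RL_integral b \<alpha> i h) = c' * h p"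
    with c one have "c' * indicator (cbox 0 b) p = c * indicator (cbox 0 b) p"
      by metis
    with assms(1) show "c' = c"
      by simp
  qed (fact c)
qed

end

theory Submission
  imports Defs
begin

text \<open>
  A fractional derivation \<open>D\<close> at \<open>p\<close> is prescribed on every fractional integral: it sends
  \<open>RL_integral b \<alpha> i h\<close> to \<open>c * h p\<close>. Since the domain of \<open>D\<close> consists of such integrals only, \<open>D\<close> is
  determined by the scalar \<open>c\<close>, and it is \<open>c\<close> times the functional \<open>f \<mapsto> h p\<close> where
  \<open>f = RL_integral b \<alpha> i h\<close>, that is, \<open>c\<close> times the Caputo derivative at \<open>p\<close>
  (\<open>fractional_derivation_eq_scalar_caputo\<close>). The algebra is short; two analytic facts give it content.

  First, the fractional integral of a continuous function on the rectangle is continuous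
  (\<open>RL_integral_continuous_funs\<close>), so that all these integrals lie in the domain. The substitution
  \<open>\<xi> = x $ i * s\<close> turns the moving singular kernel into a fixed integrable weight on \<open>{0..1}\<close>, and
  uniform continuity of the integrand does the rest.

  Second, the fractional integral is injective on continuous functions (\<open>RL_integral_inj_on\<close>), so
  that the Caputo derivative recovers \<open>h\<close> from its integral. In one variable this is Abel's argument:
  composing with the integral of the complementary order \<open>1 - \<alpha>\<close> gives a positive multiple of the
  ordinary integral, whose derivative is the function itself. The composition identity
  (\<open>Abel_composition\<close>) is verified on monomials by means of the Beta function and extended to all
  continuous functions by the approximation theorem of Weierstrass, with no exchange of the order
  of integration.

  The space of derivations is therefore the span of the Caputo functional. It is one-dimensional
  because that functional does not vanish on the fractional integral of the constant \<open>1\<close>.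
\<close>

section \<open>Integrals against an integrable weight\<close>

lemma integrable_weight_mult:
  fixes w f :: "real \<Rightarrow> real"
  assumes "w integrable_on {a..b}" "\<And>s. s \<in> {a..b} \<Longrightarrow> 0 \<le> w s" "continuous_on {a..b} f"
  shows "(\<lambda>s. w s * f s) integrable_on {a..b}"
proof -
  have "bounded (f ` {a..b})"
    by (intro compact_imp_bounded compact_continuous_image assms(3)) auto
  moreover have "f \<in> borel_measurable (lebesgue_on {a..b})"
    by (intro continuous_imp_measurable_on_sets_lebesgue assms(3)) auto
  ultimately have "(\<lambda>s. f s * w s) absolutely_integrable_on {a..b}"
    using nonnegative_absolutely_integrable_1[OF assms(1,2)]
    by (intro absolutely_integrable_bounded_measurable_product_real) auto
  then show ?thesis
    by (auto simp: mult.commute intro: set_lebesgue_integral_eq_integral(1))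
qed

lemma abs_integral_weight_mult_le:
  fixes w f :: "real \<Rightarrow> real"
  assumes "w integrable_on {a..b}" "\<And>s. s \<in> {a..b} \<Longrightarrow> 0 \<le> w s" "continuous_on {a..b} f"
    and "\<And>s. s \<in> {a..b} \<Longrightarrow> \<bar>f s\<bar> \<le> e"
  shows "\<bar>integral {a..b} (\<lambda>s. w s * f s)\<bar> \<le> integral {a..b} w * e"
proof -
  have "norm (integral {a..b} (\<lambda>s. w s * f s)) \<le> integral {a..b} (\<lambda>s. w s * e)"
    using assms integrable_on_mult_left[OF assms(1), of e]
    by (intro Henstock_Kurzweil_Integration.integral_norm_bound_integral integrable_weight_mult)
      (auto simp: abs_mult intro: mult_left_mono)
  then show ?thesis
    by simp
qed

text \<open>
  On the compact set \<open>K \<times> {a..b}\<close> the function \<open>F\<close> is uniformly continuous, so a small change of \<open>x\<close>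
  moves \<open>F x\<close> uniformly little, and hence the integral by at most \<open>integral w\<close> times as much. With
  an unbounded weight this shows that an integral with a singular kernel depends continuously
  on its parameter.
\<close>

lemma continuous_on_weighted_integral:
  fixes w :: "real \<Rightarrow> real" and F :: "'a::metric_space \<Rightarrow> real \<Rightarrow> real"
  assumes w: "w integrable_on {a..b}" "\<And>s. s \<in> {a..b} \<Longrightarrow> 0 \<le> w s"
    and K: "compact K" and F: "continuous_on (K \<times> {a..b}) (\<lambda>(x, s). F x s)"
  shows "continuous_on K (\<lambda>x. integral {a..b} (\<lambda>s. w s * F x s))"
proof -
  define W where "W = integral {a..b} w"
  have "0 \<le> W"
    unfolding W_def using w by (intro Henstock_Kurzweil_Integration.integral_nonneg) auto
  have slice: "continuous_on {a..b} (F x)" if "x \<in> K" for x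
  proof -
    have "continuous_on {a..b} ((\<lambda>(x, s). F x s) \<circ> (\<lambda>s. (x, s)))"
      using that by (intro continuous_on_compose continuous_on_subset[OF F] continuous_intros) auto
    then show ?thesis
      by (simp add: o_def)
  qed
  have unif: "uniformly_continuous_on (K \<times> {a..b}) (\<lambda>(x, s). F x s)"
    using K by (intro compact_uniformly_continuous F compact_Times) auto
  show ?thesis
    unfolding continuous_on_iff
  proof (intro ballI allI impI)
    fix x and e :: real
    assume "x \<in> K" "0 < e"
    \<comment> \<open>The summand \<open>1\<close> avoids a division by zero when \<open>w\<close> has integral zero.\<close>
    define e' where "e' = e / (W + 1)"
    have "0 < e'"
      using \<open>0 < e\<close> \<open>0 \<le> W\<close> by (simp add: e'_def)
    have "W * e' < e"
      using \<open>0 < e\<close> \<open>0 \<le> W\<close> by (simp add: e'_def field_simps)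
    obtain d where "0 < d" and d: "\<And>y s. y \<in> K \<Longrightarrow> s \<in> {a..b} \<Longrightarrow> dist y x < d \<Longrightarrow> \<bar>F y s - F x s\<bar> < e'"
    proof -
      obtain d where "0 < d" and d: "\<And>q q'. q \<in> K \<times> {a..b} \<Longrightarrow> q' \<in> K \<times> {a..b} \<Longrightarrow> dist q' q < d \<Longrightarrow>
          dist (case q' of (x, s) \<Rightarrow> F x s) (case q of (x, s) \<Rightarrow> F x s) < e'"
        using uniformly_continuous_onE[OF unif \<open>0 < e'\<close>] by metis
      show thesis
        using that[OF \<open>0 < d\<close>] d[of "(x, s)" "(y, s)" for y s] \<open>x \<in> K\<close>
        by (simp add: dist_Pair_Pair dist_real_def)
    qed
    show "\<exists>d>0. \<forall>y\<in>K. dist y x < d \<longrightarrow>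
        dist (integral {a..b} (\<lambda>s. w s * F y s)) (integral {a..b} (\<lambda>s. w s * F x s)) < e"
    proof (intro exI[of _ d] conjI \<open>0 < d\<close> ballI impI)
      fix y assume y: "y \<in> K" "dist y x < d"
      have "integral {a..b} (\<lambda>s. w s * F y s) - integral {a..b} (\<lambda>s. w s * F x s)
          = integral {a..b} (\<lambda>s. w s * (F y s - F x s))"
        unfolding right_diff_distrib using slice \<open>x \<in> K\<close> y w
        by (intro Henstock_Kurzweil_Integration.integral_diff[symmetric] integrable_weight_mult) auto
      moreover have "\<bar>integral {a..b} (\<lambda>s. w s * (F y s - F x s))\<bar> \<le> W * e'"
        unfolding W_def using slice \<open>x \<in> K\<close> y d w
        by (intro abs_integral_weight_mult_le continuous_intros) (auto intro: less_imp_le)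
      ultimately show "dist (integral {a..b} (\<lambda>s. w s * F y s)) (integral {a..b} (\<lambda>s. w s * F x s)) < e"
        using \<open>W * e' < e\<close> by (simp add: dist_real_def)
    qed
  qed
qed

text \<open>
  By linearity \<open>L\<close> vanishes on polynomials, which are uniformly dense by the theorem of
  Weierstrass, and \<open>L\<close> is continuous for the supremum norm. Homogeneity and additivity are
  required only on continuous functions, since an integral is additive only where it exists.
\<close>

lemma bounded_linear_functional_zero_if_zero_on_monomials:
  fixes L :: "(real \<Rightarrow> real) \<Rightarrow> real"
  assumes add: "\<And>f g. continuous_on {a..b} f \<Longrightarrow> continuous_on {a..b} g \<Longrightarrow>
      L (\<lambda>x. f x + g x) = L f + L g"
    and scale: "\<And>c f. continuous_on {a..b} f \<Longrightarrow> L (\<lambda>x. c * f x) = c * L f"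
    and bound: "\<And>f e. continuous_on {a..b} f \<Longrightarrow> (\<And>x. x \<in> {a..b} \<Longrightarrow> \<bar>f x\<bar> \<le> e) \<Longrightarrow> \<bar>L f\<bar> \<le> C * e"
    and monomial: "\<And>n. L (\<lambda>x. x ^ n) = 0"
    and f: "continuous_on {a..b} f"
  shows "L f = 0"
proof (rule ccontr)
  assume "L f \<noteq> 0"
  define e where "e = \<bar>L f\<bar> / (\<bar>C\<bar> + 1)"
  have "0 < e"
    using \<open>L f \<noteq> 0\<close> by (simp add: e_def)
  have "C * e \<le> \<bar>C\<bar> * e"
    using \<open>0 < e\<close> by (intro mult_right_mono) auto
  also have "\<dots> < \<bar>L f\<bar>"
    using \<open>L f \<noteq> 0\<close> by (simp add: e_def field_simps)
  finally have small: "C * e < \<bar>L f\<bar>" .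
  obtain q where q: "real_polynomial_function q" "\<And>x. x \<in> {a..b} \<Longrightarrow> \<bar>f x - q x\<bar> < e"
    using Stone_Weierstrass_real_polynomial_function[OF compact_Icc f \<open>0 < e\<close>] by metis
  obtain c n where q_eq: "q = (\<lambda>x. \<Sum>i\<le>n. c i * x ^ i)"
    using q(1) by (auto simp: real_polynomial_function_iff_sum)
  have cont: "continuous_on {a..b} (\<lambda>x. \<Sum>i\<le>n. c i * x ^ i)" for n
    by (intro continuous_intros)
  have term0: "L (\<lambda>x. c i * x ^ i) = 0" for i
    by (subst scale) (auto simp: monomial intro: continuous_intros)
  have "L (\<lambda>x. \<Sum>i\<le>n. c i * x ^ i) = 0" for n
  proof (induction n)
    case 0
    then show ?case using term0[of 0] by simp
  next
    case (Suc n)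
    have "L (\<lambda>x. (\<Sum>i\<le>n. c i * x ^ i) + c (Suc n) * x ^ Suc n) = 0"
      using Suc.IH term0[of "Suc n"] by (subst add[OF cont]) (auto intro!: continuous_intros)
    then show ?case by simp
  qed
  then have "L q = 0"
    by (simp add: q_eq)
  have "L f = L (\<lambda>x. (f x - q x) + q x)"
    by simp
  also have "\<dots> = L (\<lambda>x. f x - q x) + L q"
    using cont[of n] f by (intro add continuous_intros) (auto simp: q_eq)
  finally have "L f = L (\<lambda>x. f x - q x)"
    using \<open>L q = 0\<close> by simp
  moreover have "\<bar>L (\<lambda>x. f x - q x)\<bar> \<le> C * e"
    using cont[of n] f q(2) by (intro bound continuous_intros) (auto simp: q_eq intro: less_imp_le)
  ultimately show False
    using small by simp
qed

section \<open>Abel's composition identity\<close>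

text \<open>
  For \<open>n = 0\<close> the integrand differs from that of the Beta integral at the point \<open>0\<close>, since
  \<open>0 ^ 0 = 1\<close> but \<open>0 powr 0 = 0\<close>; one point does not affect the integral.
\<close>

lemma has_integral_Beta_monomial_left:
  fixes \<beta> :: real
  assumes "0 < \<beta>"
  shows "((\<lambda>s. (1 - s) powr (\<beta> - 1) * s ^ n) has_integral Beta (real n + 1) \<beta>) {0..1}"
proof (rule has_integral_spike_finite[of "{0}"])
  show "((\<lambda>s. s powr (real n + 1 - 1) * (1 - s) powr (\<beta> - 1)) has_integral Beta (real n + 1) \<beta>) {0..1}"
    using assms by (intro has_integral_Beta_real) auto
qed (auto simp: powr_realpow)

lemma has_integral_Beta_monomial_right:
  fixes \<alpha> :: real
  assumes "0 < \<alpha>" "\<alpha> < 1"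
  shows "((\<lambda>r. r powr \<alpha> * (1 - r) powr (- \<alpha>) * r ^ n) has_integral
      Beta (\<alpha> + real n + 1) (1 - \<alpha>)) {0..1}"
proof (rule has_integral_spike_finite[of "{0}"])
  show "((\<lambda>r. r powr (\<alpha> + real n + 1 - 1) * (1 - r) powr (1 - \<alpha> - 1)) has_integral
      Beta (\<alpha> + real n + 1) (1 - \<alpha>)) {0..1}"
    using assms by (intro has_integral_Beta_real) auto
qed (auto simp: powr_add powr_realpow)

lemma
  fixes \<alpha> :: real
  assumes "0 < \<alpha>"
  shows integrable_RL_weight: "(\<lambda>s. (1 - s) powr (\<alpha> - 1)) integrable_on {0..1}"
    and integrable_Abel_weight: "\<alpha> < 1 \<Longrightarrow> (\<lambda>r. r powr \<alpha> * (1 - r) powr (- \<alpha>)) integrable_on {0..1}"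
  using has_integral_Beta_monomial_left[of \<alpha> 0] has_integral_Beta_monomial_right[of \<alpha> 0] assms
  by (auto simp: integrable_on_def)

text \<open>
  This is the semigroup law \<open>I\<^sup>1\<^sup>-\<^sup>\<alpha> \<circ> I\<^sup>\<alpha> = I\<^sup>1\<close> at the point \<open>1\<close>, with both integrals rescaled to the
  unit interval: there \<open>I\<^sup>\<alpha> f r\<close> is \<open>r powr \<alpha>\<close> times the inner integral, up to the factor
  \<open>Gamma \<alpha>\<close>, which explains the weight \<open>r powr \<alpha>\<close>. The usual proof exchanges the order of
  integration. Here both sides are instead viewed as functionals of \<open>f\<close> that are bounded for the
  supremum norm, so that it suffices to compare them for \<open>f x = x ^ n\<close>. Averaging over dilations
  maps a monomial to a multiple of itself; the two multiples are values of the Beta function,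
  and their product is \<open>Gamma \<alpha> * Gamma (1 - \<alpha>) / (n + 1)\<close>.
\<close>

lemma Abel_composition:
  fixes f :: "real \<Rightarrow> real"
  assumes \<alpha>: "0 < \<alpha>" "\<alpha> < 1" and f: "continuous_on {0..1} f"
  shows "integral {0..1} (\<lambda>r. r powr \<alpha> * (1 - r) powr (- \<alpha>) *
      integral {0..1} (\<lambda>s. (1 - s) powr (\<alpha> - 1) * f (r * s)))
    = Gamma \<alpha> * Gamma (1 - \<alpha>) * integral {0..1} f"
proof -
  define v w where "v = (\<lambda>r::real. r powr \<alpha> * (1 - r) powr (- \<alpha>))"
    and "w = (\<lambda>s::real. (1 - s) powr (\<alpha> - 1))"
  define K where "K = Gamma \<alpha> * Gamma (1 - \<alpha>)"
  define T where "T = (\<lambda>f r. integral {0..1} (\<lambda>s. w s * f (r * s :: real)))"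
  define L where "L = (\<lambda>f. integral {0..1} (\<lambda>r. v r * T f r) - K * integral {0..1} f)"
  define V W where "V = integral {0..1} v" and "W = integral {0..1} w"
  have v: "v integrable_on {0..1}" "\<And>r. 0 \<le> v r" and w: "w integrable_on {0..1}" "\<And>s. 0 \<le> w s"
    using integrable_RL_weight[OF \<alpha>(1)] integrable_Abel_weight[OF \<alpha>(1)] \<alpha> by (auto simp: v_def w_def)
  have K: "0 < K"
    using \<alpha> by (simp add: K_def Gamma_real_pos)
  have unit: "r * s \<in> {0..1}" if "r \<in> {0..1}" "s \<in> {0..1}" for r s :: real
    using that by (auto intro: mult_le_one)
  have dil: "continuous_on {0..1} (\<lambda>s. g (r * s))"
    if "continuous_on {0..1} g" "r \<in> {0..1}" for g :: "real \<Rightarrow> real" and r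
    using unit that by (intro continuous_on_compose2[OF that(1)] continuous_intros) auto
  have contT: "continuous_on {0..1} (T g)" if "continuous_on {0..1} g" for g
    unfolding T_def using w unit
    by (intro continuous_on_weighted_integral)
      (auto simp: case_prod_unfold intro!: continuous_on_compose2[OF that] continuous_on_mult continuous_on_fst continuous_on_snd continuous_on_id)
  have wint: "(\<lambda>s. w s * g (r * s)) integrable_on {0..1}"
    if "continuous_on {0..1} g" "r \<in> {0..1}" for g r
    using w dil[OF that] by (intro integrable_weight_mult) auto
  have vint: "(\<lambda>r. v r * T g r) integrable_on {0..1}" if "continuous_on {0..1} g" for g
    using v contT[OF that] by (intro integrable_weight_mult) auto
  have "L f = 0"
  proof (rule bounded_linear_functional_zero_if_zero_on_monomials[of 0 1 L "V * W + K"])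
    fix g h :: "real \<Rightarrow> real"
    assume g: "continuous_on {0..1} g" and h: "continuous_on {0..1} h"
    have "T (\<lambda>x. g x + h x) r = T g r + T h r" if "r \<in> {0..1}" for r
      unfolding T_def using wint[OF g that] wint[OF h that]
      by (simp add: distrib_left Henstock_Kurzweil_Integration.integral_add)
    then have "integral {0..1} (\<lambda>r. v r * T (\<lambda>x. g x + h x) r)
        = integral {0..1} (\<lambda>r. v r * T g r + v r * T h r)"
      by (intro Henstock_Kurzweil_Integration.integral_cong) (simp add: distrib_left)
    then show "L (\<lambda>x. g x + h x) = L g + L h"
      using vint[OF g] vint[OF h] g h
      by (simp add: L_def Henstock_Kurzweil_Integration.integral_add integrable_continuous_real
          algebra_simps)
  next
    fix c and g :: "real \<Rightarrow> real"
    show "L (\<lambda>x. c * g x) = c * L g"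
      by (simp add: L_def T_def mult.left_commute[of _ c] right_diff_distrib)
  next
    fix g :: "real \<Rightarrow> real" and e
    assume g: "continuous_on {0..1} g" and e: "\<And>x. x \<in> {0..1} \<Longrightarrow> \<bar>g x\<bar> \<le> e"
    have "\<bar>T g r\<bar> \<le> W * e" if "r \<in> {0..1}" for r
      unfolding T_def W_def using w dil[OF g that] e unit[OF that]
      by (intro abs_integral_weight_mult_le) auto
    then have "\<bar>integral {0..1} (\<lambda>r. v r * T g r)\<bar> \<le> V * (W * e)"
      unfolding V_def using v contT[OF g] by (intro abs_integral_weight_mult_le) auto
    moreover have "\<bar>integral {0..1} g\<bar> \<le> e"
      using abs_integral_weight_mult_le[of "\<lambda>_. 1" 0 1 g e] g e by auto
    then have "\<bar>K * integral {0..1} g\<bar> \<le> K * e"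
      using K by (simp add: abs_mult)
    ultimately show "\<bar>L g\<bar> \<le> (V * W + K) * e"
      unfolding L_def by (auto simp: algebra_simps intro: order_trans[OF abs_triangle_ineq4])
  next
    fix n
    have "T (\<lambda>x. x ^ n) r = Beta (real n + 1) \<alpha> * r ^ n" for r
      using integral_unique[OF has_integral_Beta_monomial_left[OF \<alpha>(1), of n]]
      by (simp add: T_def w_def power_mult_distrib mult.left_commute[of _ "r ^ n"])
    then have "integral {0..1} (\<lambda>r. v r * T (\<lambda>x. x ^ n) r)
        = Beta (real n + 1) \<alpha> * Beta (\<alpha> + real n + 1) (1 - \<alpha>)"
      using integral_unique[OF has_integral_Beta_monomial_right[OF \<alpha>, of n]]
      by (simp add: v_def mult.left_commute[of _ "Beta (real n + 1) \<alpha>"])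
    also have "\<dots> = K / (real n + 1)"
    proof -
      have Gamma_step: "Gamma (\<alpha> + real n + 1 + (1 - \<alpha>)) = (real n + 1) * Gamma (real n + 1)"
      proof -
        have "real n + 1 \<notin> \<int>\<^sub>\<le>\<^sub>0"
          by (auto dest: nonpos_Ints_nonpos)
        then show ?thesis
          using Gamma_plus1[of "real n + 1"] by (simp add: add_ac)
      qed
      have pos: "Gamma (real n + 1) > 0" "Gamma (\<alpha> + real n + 1) > 0"
        using \<alpha> by (auto intro: Gamma_real_pos)
      have cancel: "g * x / h * (h * y / (m * g)) = x * y / m" if "g > 0" "h > 0" for g h m x y :: real
        using that by (simp add: field_simps)
      have comm: "real n + 1 + \<alpha> = \<alpha> + real n + 1"
        by simp
      show ?thesis
        unfolding Beta_def K_def Gamma_step comm by (rule cancel[OF pos])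
    qed
    finally have "integral {0..1} (\<lambda>r. v r * T (\<lambda>x. x ^ n) r) = K / (real n + 1)" .
    moreover have "((\<lambda>x. x ^ n) has_integral 1 / (real n + 1)) {0..1::real}"
    proof -
      have "((\<lambda>x. x ^ Suc n / (real n + 1)) has_real_derivative x ^ n) (at x within {0..1})" for x
        using DERIV_cdivide[OF DERIV_pow[of "Suc n" x "{0..1}"], of "real n + 1"] by (simp add: add_ac)
      then have "((\<lambda>x. x ^ n) has_integral 1 ^ Suc n / (real n + 1) - 0 ^ Suc n / (real n + 1)) {0..1::real}"
        by (intro fundamental_theorem_of_calculus)
          (auto simp flip: has_real_derivative_iff_has_vector_derivative simp del: power_Suc)
      then show ?thesis
        by simp
    qed
    ultimately show "L (\<lambda>x. x ^ n) = 0"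
      by (simp add: L_def integral_unique)
  qed (fact f)
  then show ?thesis
    by (simp add: L_def T_def K_def v_def w_def)
qed

text \<open>
  The substitution \<open>\<xi> = x * s\<close>. On the right the singularity no longer moves with \<open>x\<close>, so that
  the results on a fixed weight apply. At \<open>x = 0\<close> both sides are zero, the right one because
  \<open>0 powr \<alpha> = 0\<close>.
\<close>

lemma RL_kernel_eq_unit_interval:
  fixes x \<alpha> :: real
  assumes "0 \<le> x"
  shows "integral {0..x} (\<lambda>\<xi>. (x - \<xi>) powr (\<alpha> - 1) * g \<xi>)
    = x powr \<alpha> * integral {0..1} (\<lambda>s. (1 - s) powr (\<alpha> - 1) * g (x * s))"
proof (cases "x = 0")
  case False
  with assms have "0 < x" by simp
  let ?F = "\<lambda>\<xi>. (x - \<xi>) powr (\<alpha> - 1) * g \<xi>"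
  have "?F (x * s) = x powr (\<alpha> - 1) * ((1 - s) powr (\<alpha> - 1) * g (x * s))" if "s \<in> {0..1}" for s
  proof -
    have "x - x * s = x * (1 - s)"
      by (simp add: algebra_simps)
    then show ?thesis
      using \<open>0 < x\<close> that by (simp add: powr_mult)
  qed
  then have "integral {0..1} (\<lambda>s. ?F (x * s))
      = integral {0..1} (\<lambda>s. x powr (\<alpha> - 1) * ((1 - s) powr (\<alpha> - 1) * g (x * s)))"
    by (intro Henstock_Kurzweil_Integration.integral_cong)
  also have "\<dots> = x powr (\<alpha> - 1) * integral {0..1} (\<lambda>s. (1 - s) powr (\<alpha> - 1) * g (x * s))"
    by (rule Henstock_Kurzweil_Integration.integral_mult_right)
  finally have "integral {0..1} (\<lambda>s. ?F (x * s))
      = x powr (\<alpha> - 1) * integral {0..1} (\<lambda>s. (1 - s) powr (\<alpha> - 1) * g (x * s))" .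
  moreover have "integral {0..1} (\<lambda>s. ?F (x * s)) = integral {0..x} ?F / x"
    using integral_stretch_real[of x 0 x ?F] \<open>0 < x\<close> by simp
  moreover have "x powr \<alpha> = x * x powr (\<alpha> - 1)"
    using \<open>0 < x\<close> by (simp add: powr_diff)
  ultimately have "integral {0..x} ?F / x
      = x powr \<alpha> / x * integral {0..1} (\<lambda>s. (1 - s) powr (\<alpha> - 1) * g (x * s))"
    using \<open>0 < x\<close> by simp
  then show ?thesis
    using \<open>0 < x\<close> by simp
qed simp

lemma zero_if_all_initial_integrals_zero:
  fixes g :: "real \<Rightarrow> real"
  assumes "0 < c" and g: "continuous_on {0..c} g"
    and zero: "\<And>y. y \<in> {0..c} \<Longrightarrow> integral {0..y} g = 0"
    and y: "y \<in> {0..c}"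
  shows "g y = 0"
proof (rule vector_derivative_unique_within_closed_interval[of 0 c y "\<lambda>u. integral {0..u} g"])
  show "((\<lambda>u. integral {0..u} g) has_vector_derivative g y) (at y within cbox 0 c)"
    using integral_has_vector_derivative[OF g y] by simp
  show "((\<lambda>u. integral {0..u} g) has_vector_derivative 0) (at y within cbox 0 c)"
    using y zero by (intro has_vector_derivative_transform[OF _ _ has_vector_derivative_const[of 0]]) auto
qed (use \<open>0 < c\<close> y in auto)

text \<open>
  If the fractional integral of \<open>g\<close> vanishes, then so does the inner integral in Abel's identity for
  the dilated function \<open>s \<mapsto> g (y * s)\<close>, and the identity shows that the ordinary integral of \<open>g\<close>
  over \<open>{0..y}\<close> is zero, for every \<open>y\<close>.
\<close>

lemma Abel_kernel_trivial:
  fixes g :: "real \<Rightarrow> real"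
  assumes \<alpha>: "0 < \<alpha>" "\<alpha> < 1" and "0 < c" and g: "continuous_on {0..c} g"
    and zero: "\<And>y. y \<in> {0<..c} \<Longrightarrow> integral {0..y} (\<lambda>\<xi>. (y - \<xi>) powr (\<alpha> - 1) * g \<xi>) = 0"
    and y: "y \<in> {0..c}"
  shows "g y = 0"
proof (rule zero_if_all_initial_integrals_zero[OF \<open>0 < c\<close> g _ y])
  fix y assume y: "y \<in> {0..c}"
  show "integral {0..y} g = 0"
  proof (cases "y = 0")
    case False
    with y have "0 < y" by simp
    have dil: "y * r \<in> {0..c}" if "r \<in> {0..1}" for r
      using that y mult_left_mono[of r 1 y] by auto
    then have cont: "continuous_on {0..1} (\<lambda>s. g (y * s))"
      by (intro continuous_on_compose2[OF g] continuous_intros) auto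
    have inner: "r powr \<alpha> * (1 - r) powr (- \<alpha>) *
        integral {0..1} (\<lambda>s. (1 - s) powr (\<alpha> - 1) * g (y * (r * s))) = 0" if "r \<in> {0..1}" for r
    \<comment> \<open>At \<open>r = 0\<close> the inner integral is a multiple of \<open>g 0\<close>, not known to be zero yet; the weight
        \<open>0 powr \<alpha> = 0\<close> removes it.\<close>
    proof (cases "r = 0")
      case False
      with that y \<open>0 < y\<close> have "y * r \<in> {0<..c}"
        using dil[of r] by auto
      then show ?thesis
        using zero[of "y * r"] RL_kernel_eq_unit_interval[of "y * r" \<alpha> g] False \<open>0 < y\<close>
        by (auto simp: mult.assoc)
    qed simp
    have "Gamma \<alpha> * Gamma (1 - \<alpha>) * integral {0..1} (\<lambda>s. g (y * s)) = 0"
      unfolding Abel_composition[OF \<alpha> cont, symmetric]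
      using Henstock_Kurzweil_Integration.integral_cong[of "{0..1}", OF inner] by simp
    moreover have "Gamma \<alpha> > 0" "Gamma (1 - \<alpha>) > 0"
      using \<alpha> by (auto intro: Gamma_real_pos)
    moreover have "integral {0..1} (\<lambda>s. g (y * s)) = integral {0..y} g / y"
      using integral_stretch_real[of y 0 y g] \<open>0 < y\<close> by simp
    ultimately show ?thesis
      using \<open>0 < y\<close> by simp
  qed simp
qed

section \<open>The Riemann--Liouville integral on a rectangle\<close>

definition coord_upd :: "real ^ 'n \<Rightarrow> 'n \<Rightarrow> real \<Rightarrow> real ^ 'n" where
  "coord_upd x i t = (\<chi> j. if j = i then t else x $ j)"

lemma coord_upd_simps [simp]:
  "coord_upd x i t $ i = t" "coord_upd x i (x $ i) = x"
  by (auto simp: coord_upd_def vec_eq_iff)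

lemma coord_upd_in_cbox: "x \<in> cbox a b \<Longrightarrow> t \<in> {a $ i..b $ i} \<Longrightarrow> coord_upd x i t \<in> cbox a b"
  by (auto simp: coord_upd_def mem_box_cart)

lemma continuous_on_coord_upd [continuous_intros]:
  assumes "continuous_on S f" "continuous_on S g"
  shows "continuous_on S (\<lambda>x. coord_upd (f x) i (g x))"
  unfolding coord_upd_def
proof (rule continuous_on_vec_lambda)
  fix j show "continuous_on S (\<lambda>x. if j = i then g x else f x $ j)"
    using assms by (cases "j = i") (auto intro: continuous_intros)
qed

lemma continuous_on_continuous_funs_comp:
  assumes "h \<in> continuous_funs U" "continuous_on S g" "\<And>x. x \<in> S \<Longrightarrow> g x \<in> U"
  shows "continuous_on S (\<lambda>x. h (g x))"
  using assms by (intro continuous_on_compose2[of U h S g]) (auto simp: continuous_funs_def)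

lemma scaled_coord_in_cbox:
  fixes x b :: "real ^ 'n"
  assumes "x \<in> cbox 0 b" "s \<in> {0..1}"
  shows "coord_upd x i (x $ i * s) \<in> cbox 0 b"
proof -
  have "0 \<le> x $ i" "x $ i \<le> b $ i"
    using assms(1) by (auto simp: mem_box_cart)
  then have "x $ i * s \<in> {0..b $ i}"
    using assms(2) mult_left_le[of s "x $ i"] by auto
  then show ?thesis
    using assms(1) by (intro coord_upd_in_cbox) auto
qed

lemma RL_integral_eq_weighted:
  fixes x b :: "real ^ 'n"
  assumes "x \<in> cbox 0 b"
  shows "RL_integral b \<alpha> i h x = 1 / Gamma \<alpha> * (x $ i powr \<alpha> *
    integral {0..1} (\<lambda>s. (1 - s) powr (\<alpha> - 1) * h (coord_upd x i (x $ i * s))))"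
  using assms RL_kernel_eq_unit_interval[of "x $ i" \<alpha> "\<lambda>t. h (coord_upd x i t)"]
  by (simp add: RL_integral_def mem_box_cart coord_upd_def)

text \<open>
  Consequently every fractional integral of a continuous function belongs to \<open>RL_range\<close>. This is what
  makes the Caputo functional a derivation, and a nonzero one.
\<close>

lemma RL_integral_continuous_funs:
  fixes b :: "real ^ 'n"
  assumes "0 < \<alpha>" and h: "h \<in> continuous_funs (cbox 0 b)"
  shows "RL_integral b \<alpha> i h \<in> continuous_funs (cbox 0 b)"
proof -
  have "continuous_on (cbox 0 b)
      (\<lambda>x. integral {0..1} (\<lambda>s. (1 - s) powr (\<alpha> - 1) * h (coord_upd x i (x $ i * s))))"
  proof (rule continuous_on_weighted_integral)
    show "continuous_on (cbox 0 b \<times> {0..1}) (\<lambda>(x, s). h (coord_upd x i (x $ i * s)))"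
      unfolding case_prod_unfold
      by (rule continuous_on_continuous_funs_comp[OF h])
        (auto intro!: scaled_coord_in_cbox continuous_intros simp del: mem_box)
  qed (use assms integrable_RL_weight in auto)
  moreover have "continuous_on (cbox 0 b) (\<lambda>x. x $ i powr \<alpha>)"
    using \<open>0 < \<alpha>\<close> by (intro continuous_on_powr' continuous_intros) (auto simp: mem_box_cart)
  ultimately have "continuous_on (cbox 0 b) (\<lambda>x. 1 / Gamma \<alpha> * (x $ i powr \<alpha> *
      integral {0..1} (\<lambda>s. (1 - s) powr (\<alpha> - 1) * h (coord_upd x i (x $ i * s)))))"
    by (intro continuous_on_mult_left continuous_on_mult)
  then have "continuous_on (cbox 0 b) (RL_integral b \<alpha> i h)"
    by (rule continuous_on_eq) (simp add: RL_integral_eq_weighted)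
  then show ?thesis
    by (simp add: continuous_funs_def RL_integral_def)
qed

lemma RL_integrand_integrable:
  fixes x b :: "real ^ 'n"
  assumes "0 < \<alpha>" and h: "h \<in> continuous_funs (cbox 0 b)" and x: "x \<in> cbox 0 b"
  shows "(\<lambda>s. (1 - s) powr (\<alpha> - 1) * h (coord_upd x i (x $ i * s))) integrable_on {0..1}"
proof (rule integrable_weight_mult)
  show "continuous_on {0..1} (\<lambda>s. h (coord_upd x i (x $ i * s)))"
    by (rule continuous_on_continuous_funs_comp[OF h])
      (auto intro!: scaled_coord_in_cbox[OF x] continuous_intros simp del: mem_box)
qed (use assms integrable_RL_weight in auto)

lemma RL_integral_add:
  assumes "0 < \<alpha>" and h: "h \<in> continuous_funs (cbox 0 b)" and k: "k \<in> continuous_funs (cbox 0 b)"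
  shows "RL_integral b \<alpha> i (h + k) = RL_integral b \<alpha> i h + RL_integral b \<alpha> i k"
proof
  fix x
  show "RL_integral b \<alpha> i (h + k) x = (RL_integral b \<alpha> i h + RL_integral b \<alpha> i k) x"
  proof (cases "x \<in> cbox 0 b")
    case True
    then show ?thesis
      using RL_integrand_integrable[OF \<open>0 < \<alpha>\<close> h True, of i] RL_integrand_integrable[OF \<open>0 < \<alpha>\<close> k True, of i]
      by (simp add: RL_integral_eq_weighted plus_fun_def distrib_left
          Henstock_Kurzweil_Integration.integral_add)
  qed (simp add: RL_integral_def)
qed

lemma RL_integral_fscale: "RL_integral b \<alpha> i (fscale c h) = fscale c (RL_integral b \<alpha> i h)"
  by (auto simp: fun_eq_iff RL_integral_def fscale_def mult.left_commute[of _ c])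

text \<open>
  The integral acts along lines parallel to the \<open>i\<close>-th axis. On each such line, the difference of
  two functions with the same fractional integral lies in the kernel of the one-dimensional
  operator, which is trivial. This uniqueness is what makes the Caputo derivative well defined.
\<close>

lemma RL_integral_inj_on:
  fixes b :: "real ^ 'n"
  assumes \<alpha>: "0 < \<alpha>" "\<alpha> < 1" and "0 < b $ i"
  shows "inj_on (RL_integral b \<alpha> i) (continuous_funs (cbox 0 b))"
proof (rule inj_onI)
  fix h k
  assume h: "h \<in> continuous_funs (cbox 0 b)" and k: "k \<in> continuous_funs (cbox 0 b)"
    and eq: "RL_integral b \<alpha> i h = RL_integral b \<alpha> i k"
  define f where "f = h + fscale (- 1) k"
  have k': "fscale (- 1) k \<in> continuous_funs (cbox 0 b)"
    using fun_space.subspace_scale[OF subspace_continuous_funs k] .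
  have f: "f \<in> continuous_funs (cbox 0 b)"
    unfolding f_def using fun_space.subspace_add[OF subspace_continuous_funs h k'] .
  have zero: "RL_integral b \<alpha> i f x = 0" for x
    unfolding f_def RL_integral_add[OF \<alpha>(1) h k'] RL_integral_fscale eq by (simp add: fscale_def)
  have "f x = 0" if x: "x \<in> cbox 0 b" for x
  proof -
    have xi: "x $ i \<in> {0..b $ i}"
      using x by (simp add: mem_box_cart)
    have line: "coord_upd x i t \<in> cbox 0 b" if "t \<in> {0..b $ i}" for t
      using x that by (intro coord_upd_in_cbox) auto
    have "f (coord_upd x i (x $ i)) = 0"
    proof (rule Abel_kernel_trivial[OF \<alpha> \<open>0 < b $ i\<close> _ _ xi])
      show "continuous_on {0..b $ i} (\<lambda>t. f (coord_upd x i t))"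
        by (rule continuous_on_continuous_funs_comp[OF f])
          (auto intro!: line continuous_intros simp del: mem_box)
      fix t assume t: "t \<in> {0<..b $ i}"
      show "integral {0..t} (\<lambda>\<xi>. (t - \<xi>) powr (\<alpha> - 1) * f (coord_upd x i \<xi>)) = 0"
      proof -
        have "coord_upd x i t \<in> cbox 0 b"
          using t by (intro line) auto
        moreover have "(\<chi> j. if j = i then \<xi> else coord_upd x i t $ j) = coord_upd x i \<xi>" for \<xi>
          by (simp add: coord_upd_def vec_eq_iff)
        moreover have "Gamma \<alpha> > 0"
          using \<alpha> by (auto intro: Gamma_real_pos)
        ultimately show ?thesis
          using zero[of "coord_upd x i t"] by (simp add: RL_integral_def)
      qed
    qed
    then show ?thesis by simp
  qed
  moreover have "h x = k x" if "x \<notin> cbox 0 b" for x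
    using h k that by (simp add: continuous_funs_def)
  ultimately show "h = k"
    by (fastforce simp: fun_eq_iff f_def fscale_def)
qed

section \<open>Fractional derivations at a point\<close>

lemma caputo_deriv_RL_integral:
  fixes b :: "real ^ 'n"
  assumes "0 < \<alpha>" "\<alpha> < 1" "0 < b $ i" and "h \<in> continuous_funs (cbox 0 b)"
  shows "caputo_deriv b \<alpha> i (RL_integral b \<alpha> i h) = h"
  unfolding caputo_deriv_def using inj_onD[OF RL_integral_inj_on[OF assms(1-3)]] assms(4) by blast

lemma RL_range_eq_image:
  assumes "0 < \<alpha>"
  shows "RL_range b \<alpha> i = RL_integral b \<alpha> i ` continuous_funs (cbox 0 b)"
  using RL_integral_continuous_funs[OF assms] by (auto simp: RL_range_def)

lemma caputo_deriv_at_RL_integral: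
  fixes b :: "real ^ 'n"
  assumes "0 < \<alpha>" "\<alpha> < 1" "0 < b $ i" and "h \<in> continuous_funs (cbox 0 b)"
  shows "caputo_deriv_at b \<alpha> i p (RL_integral b \<alpha> i h) = h p"
  using assms by (simp add: caputo_deriv_at_def caputo_deriv_RL_integral RL_range_eq_image)

lemma caputo_deriv_at_linear_functional:
  fixes b :: "real ^ 'n"
  assumes "0 < \<alpha>" "\<alpha> < 1" "0 < b $ i"
  shows "caputo_deriv_at b \<alpha> i p \<in> linear_functionals (RL_range b \<alpha> i)"
proof -
  note at = caputo_deriv_at_RL_integral[OF assms]
  have "caputo_deriv_at b \<alpha> i p (RL_integral b \<alpha> i h + RL_integral b \<alpha> i k)
      = caputo_deriv_at b \<alpha> i p (RL_integral b \<alpha> i h) + caputo_deriv_at b \<alpha> i p (RL_integral b \<alpha> i k)"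
    if "h \<in> continuous_funs (cbox 0 b)" "k \<in> continuous_funs (cbox 0 b)" for h k
    using that fun_space.subspace_add[OF subspace_continuous_funs that]
    by (simp add: at flip: RL_integral_add[OF assms(1) that])
  moreover have "caputo_deriv_at b \<alpha> i p (fscale c (RL_integral b \<alpha> i h))
      = c * caputo_deriv_at b \<alpha> i p (RL_integral b \<alpha> i h)"
    if "h \<in> continuous_funs (cbox 0 b)" for c h
    using that fun_space.subspace_scale[OF subspace_continuous_funs that]
    by (simp add: at flip: RL_integral_fscale) (simp add: fscale_def)
  ultimately show ?thesis
    using assms(1) by (auto simp: linear_functionals_def RL_range_eq_image)
      (simp_all add: caputo_deriv_at_def RL_range_eq_image)
qed

text \<open>
  Every element of the domain of \<open>D\<close> is some \<open>RL_integral b \<alpha> i h\<close>, and both functionals send it to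
  \<open>c * h p\<close>. Outside the domain both are zero by convention, so they are equal as total functions.
\<close>

lemma fractional_derivation_eq_scalar_caputo:
  fixes b :: "real ^ 'n"
  assumes "0 < \<alpha>" "\<alpha> < 1" "0 < b $ i"
    and D: "D \<in> linear_functionals (RL_range b \<alpha> i)"
    and c: "\<forall>h \<in> continuous_funs (cbox 0 b). D (RL_integral b \<alpha> i h) = c * h p"
  shows "D = fscale c (caputo_deriv_at b \<alpha> i p)"
proof
  fix f
  show "D f = fscale c (caputo_deriv_at b \<alpha> i p) f"
  proof (cases "f \<in> RL_range b \<alpha> i")
    case True
    then show ?thesis
      using assms by (auto simp: RL_range_eq_image fscale_def caputo_deriv_at_RL_integral)
  next
    case False
    then show ?thesis
      using D by (simp add: linear_functionals_def fscale_def caputo_deriv_at_def)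
  qed
qed

lemma fractional_derivations_eq_span:
  fixes b :: "real ^ 'n"
  assumes "0 < \<alpha>" "\<alpha> < 1" "0 < b $ i"
  shows "fractional_derivations b \<alpha> i p = {fscale c (caputo_deriv_at b \<alpha> i p) | c. True}"
proof (intro equalityI subsetI)
  fix D assume "D \<in> fractional_derivations b \<alpha> i p"
  then show "D \<in> {fscale c (caputo_deriv_at b \<alpha> i p) | c. True}"
    using fractional_derivation_eq_scalar_caputo[OF assms]
    unfolding fractional_derivations_def by blast
next
  fix D assume "D \<in> {fscale c (caputo_deriv_at b \<alpha> i p) | c. True}"
  then obtain c where D: "D = fscale c (caputo_deriv_at b \<alpha> i p)"
    by blast
  have "D \<in> linear_functionals (RL_range b \<alpha> i)"
    unfolding D by (intro fun_space.subspace_scale subspace_linear_functionals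
        caputo_deriv_at_linear_functional assms)
  moreover have "\<forall>h \<in> continuous_funs (cbox 0 b). D (RL_integral b \<alpha> i h) = c * h p"
    using assms by (simp add: D fscale_def caputo_deriv_at_RL_integral)
  ultimately show "D \<in> fractional_derivations b \<alpha> i p"
    by (auto simp: fractional_derivations_def)
qed

text \<open>
  The functional takes the value \<open>1\<close> at the fractional integral of the constant function \<open>1\<close> on the
  rectangle.
\<close>

lemma caputo_deriv_at_nonzero:
  fixes b :: "real ^ 'n"
  assumes "0 < \<alpha>" "\<alpha> < 1" "0 < b $ i" "p \<in> cbox 0 b"
  shows "caputo_deriv_at b \<alpha> i p \<noteq> 0"
proof
  assume zero: "caputo_deriv_at b \<alpha> i p = 0"
  have "indicator (cbox 0 b) \<in> continuous_funs (cbox 0 b)"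
    by (auto simp: continuous_funs_def indicator_def cong: continuous_on_cong)
  from caputo_deriv_at_RL_integral[OF assms(1-3) this, of p] show False
    using assms(4) by (simp add: zero)
qed

theorem theorem3p3:
  fixes \<alpha> :: real and b p :: "real ^ 'n" and i :: 'n
  assumes "0 < \<alpha>" and "\<alpha> < 1"
    and "\<forall>j. 0 < b $ j"
    and "p \<in> cbox 0 b"
  shows "fun_space.subspace (fractional_derivations b \<alpha> i p)
    \<and> fractional_derivations b \<alpha> i p \<subseteq> linear_functionals (RL_range b \<alpha> i)
    \<and> fun_space.dim (fractional_derivations b \<alpha> i p) = 1
    \<and> fractional_derivations b \<alpha> i p = {fscale c (caputo_deriv_at b \<alpha> i p) | c. True}
    \<and> (\<forall>D \<in> fractional_derivations b \<alpha> i p. \<forall>f \<in> RL_range b \<alpha> i.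
          D f = derivation_scalar b \<alpha> i p D * caputo_deriv b \<alpha> i f p)"
proof -
  let ?v = "caputo_deriv_at b \<alpha> i p"
  have bi: "0 < b $ i"
    using assms(3) by simp
  note eq = fractional_derivations_eq_span[OF assms(1,2) bi, of p]
  have span: "fractional_derivations b \<alpha> i p = fun_space.span {?v}"
    unfolding eq by (auto simp: fun_space.span_singleton)
  have subspace: "fun_space.subspace (fractional_derivations b \<alpha> i p)"
    unfolding span by (rule fun_space.subspace_span)
  have "fun_space.independent {?v}"
    using caputo_deriv_at_nonzero[OF assms(1,2) bi assms(4)]
    by (simp add: fun_space.dependent_single)
  then have dim: "fun_space.dim (fractional_derivations b \<alpha> i p) = 1"
    unfolding span by (simp add: fun_space.dim_eq_card_independent)
  have "D f = derivation_scalar b \<alpha> i p D * caputo_deriv b \<alpha> i f p"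
    if D: "D \<in> fractional_derivations b \<alpha> i p" and f: "f \<in> RL_range b \<alpha> i" for D f
  proof -
    have "\<forall>h \<in> continuous_funs (cbox 0 b). D (RL_integral b \<alpha> i h) = derivation_scalar b \<alpha> i p D * h p"
      unfolding derivation_scalar_def by (rule theI'[OF derivation_scalar_unique[OF assms(4) D]])
    with D have "D = fscale (derivation_scalar b \<alpha> i p D) ?v"
      by (intro fractional_derivation_eq_scalar_caputo assms(1,2) bi)
        (auto simp: fractional_derivations_def)
    then show ?thesis
      using f by (metis fscale_def caputo_deriv_at_def)
  qed
  moreover have "fractional_derivations b \<alpha> i p \<subseteq> linear_functionals (RL_range b \<alpha> i)"
    by (auto simp: fractional_derivations_def)
  ultimately show ?thesis
    using subspace dim eq by blast
qed

end
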